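(* Let $\omega_2=\sqrt{2+\sqrt2}$. For $\varepsilon\neq0$ sufficiently small, the differential equation $$\theta_1''=-2\theta_1+\theta_2+\varepsilon\bigl(\theta_2'+\theta_1^2\cos(\omega_2\tau)\bigr),\qquad \theta_2''=2\theta_1-2\theta_2$$ has one periodic solution $(\theta_1(\tau,\varepsilon),\theta_2(\tau,\varepsilon))$ tending when $\varepsilon\to0$ to the periodic solution $(\theta_1(\tau),\theta_2(\tau))$ of the unperturbed double pendulum ($\varepsilon=0$) given by $$\theta_1(\tau)=-\frac{1}{\sqrt{4+2\sqrt2}}\bigl(Z_0^*\cos(\omega_2\tau)+W_0^*\sin(\omega_2\tau)\bigr),\qquad \theta_2(\tau)=\frac{1}{\sqrt{2+\sqrt2}}\bigl(Z_0^*\cos(\omega_2\tau)+W_0^*\sin(\omega_2\tau)\bigr)$$ with $(Z_0^*,W_0^* )=\left(0,\,-8(2+\sqrt2)\right)$.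
   Context: The prime denotes the derivative with respect to $\tau$, and $\varepsilon$ is a real parameter. The unperturbed double pendulum is $\theta_1''=-2\theta_1+\theta_2$, $\theta_2''=2\theta_1-2\theta_2$. "Tending" means $\theta_k(\tau,\varepsilon)\to\theta_k(\tau)$ as $\varepsilon\to0$ for $k=1,2$ and every $\tau$. The conclusion is an existence statement. *)

theory Defs
  imports Complex_Main "HOL-Library.Periodic_Fun"
begin

definition omega2 :: real where
  "omega2 = sqrt (2 + sqrt 2)"

text \<open>\<open>v1\<close> and \<open>v2\<close> are the derivatives of \<open>x1\<close> and \<open>x2\<close>, so the last two conjuncts
  state the second-order equations. Solutions are defined on the whole real line.\<close>

definition is_solution :: "real \<Rightarrow> (real \<Rightarrow> real) \<Rightarrow> (real \<Rightarrow> real) \<Rightarrow> bool" where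
  "is_solution \<epsilon> x1 x2 \<longleftrightarrow>
     (\<exists>v1 v2. \<forall>\<tau>.
        (x1 has_real_derivative v1 \<tau>) (at \<tau>) \<and>
        (x2 has_real_derivative v2 \<tau>) (at \<tau>) \<and>
        (v1 has_real_derivative
           (- 2 * x1 \<tau> + x2 \<tau> + \<epsilon> * (v2 \<tau> + (x1 \<tau>)\<^sup>2 * cos (omega2 * \<tau>)))) (at \<tau>) \<and>
        (v2 has_real_derivative (2 * x1 \<tau> - 2 * x2 \<tau>)) (at \<tau>))"

text \<open>The two components share a period, which may depend on \<open>\<epsilon>\<close>.\<close>

definition is_periodic_solution :: "real \<Rightarrow> (real \<Rightarrow> real) \<Rightarrow> (real \<Rightarrow> real) \<Rightarrow> bool" where
  "is_periodic_solution \<epsilon> x1 x2 \<longleftrightarrow>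
     is_solution \<epsilon> x1 x2 \<and>
     (\<exists>T>0. periodic_fun_simple (\<lambda>\<tau>. (x1 \<tau>, x2 \<tau>)) T)"

definition unperturbed1 :: "real \<Rightarrow> real \<Rightarrow> real \<Rightarrow> real" where
  "unperturbed1 Z W \<tau> =
     - (1 / sqrt (4 + 2 * sqrt 2)) * (Z * cos (omega2 * \<tau>) + W * sin (omega2 * \<tau>))"

definition unperturbed2 :: "real \<Rightarrow> real \<Rightarrow> real \<Rightarrow> real" where
  "unperturbed2 Z W \<tau> =
     1 / sqrt (2 + sqrt 2) * (Z * cos (omega2 * \<tau>) + W * sin (omega2 * \<tau>))"

definition Z0_star :: real where
  "Z0_star = 0"

definition W0_star :: real where
  "W0_star = - 8 * (2 + sqrt 2)"

end

theory Submission imports Defs "HOL-Analysis.Analysis" begin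

text \<open>
  After rescaling time by \<open>s = omega2 \<cdot> \<tau>\<close>, the normal modes \<open>y = \<surd>2 \<theta>1 - \<theta>2\<close> and
  \<open>z = \<surd>2 \<theta>1 + \<theta>2\<close> satisfy \<open>y'' = - y + m N\<close> and \<open>z'' = - k\<^sup>2 z + m N\<close>, where
  \<open>m = \<epsilon> \<surd>2 / omega2\<^sup>2\<close>, \<open>k = \<surd>2 - 1\<close> and \<open>N = \<theta>2' + \<theta>1\<^sup>2 cos s\<close>; only the first mode
  resonates with period \<open>2\<pi>\<close>. The Lyapunov--Schmidt reduction is carried out with a single
  unknown: a \<open>2\<pi>\<close>-periodic \<open>M\<close> whose first harmonic \<open>P M\<close> is the leading part of \<open>y\<close> and whose
  remainder \<open>M - P M\<close> is \<open>N\<close>. Periodic Green's functions give \<open>y = P M + m G\<^sub>1 M\<close> and \<open>z = m G\<^sub>k M\<close>,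
  so the equation becomes \<open>M - P M = N(M)\<close>, which for \<open>m = 0\<close> has the solution
  \<open>M0 = 16 omega2 sin s - 8 omega2\<^sup>2 cos 3s\<close> with invertible linearisation. A Newton-type
  contraction near \<open>M0\<close> solves it for small \<open>m\<close>, at distance \<open>O(m)\<close> from \<open>M0\<close>.
\<close>

section \<open>Fixed points of a quadratic perturbation\<close>

text \<open>The Lipschitz factor vanishes at \<open>x0\<close> for \<open>m = 0\<close>, so
  \<open>F m\<close> halves distances on a ball around \<open>x0\<close> of radius proportional to
  |m|, and that ball is large enough to absorb the displacement of its centre.\<close>

lemma perturbed_fixed_point:
  fixes F :: "real \<Rightarrow> 'a::banach \<Rightarrow> 'a"
  assumes S: "closed S" "x0 \<in> S" and F: "\<And>m x. x \<in> S \<Longrightarrow> F m x \<in> S"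
    and F0: "\<And>m. \<bar>m\<bar> \<le> 1 \<Longrightarrow> norm (F m x0 - x0) \<le> C * \<bar>m\<bar>"
    and lip: "\<And>m x y. \<bar>m\<bar> \<le> 1 \<Longrightarrow> norm (x - x0) \<le> 1 \<Longrightarrow> norm (y - x0) \<le> 1 \<Longrightarrow>
      norm (F m x - F m y) \<le> C * (norm (x - x0) + norm (y - x0) + \<bar>m\<bar>) * norm (x - y)"
  shows "\<exists>\<delta>>0. \<exists>B X. \<forall>m. \<bar>m\<bar> < \<delta> \<longrightarrow> X m \<in> S \<and> norm (X m - x0) \<le> B * \<bar>m\<bar> \<and> F m (X m) = X m"
proof -
  \<comment> \<open>With \<open>E \<ge> 1\<close>, the bound on \<open>E * (2 * r + |m|)\<close>
    below also keeps \<open>r\<close> and |m| below 1, the range in which the hypotheses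
    apply.\<close>
  define E where "E = max C 1"
  have E: "E \<ge> 1" "C \<le> E" by (auto simp: E_def)
  \<comment> \<open>Chosen so that the radius \<open>r = 2 * E * |m|\<close> gives
    \<open>E * (2 * r + |m|) \<le> 1/2\<close>, the contraction factor.\<close>
  define \<delta> where "\<delta> = 1 / (2 * E * (4 * E + 1))"
  have \<delta>: "\<delta> > 0" using E by (auto simp: \<delta>_def)
  have ex: "\<exists>x. x \<in> S \<and> norm (x - x0) \<le> 2 * E * \<bar>m\<bar> \<and> F m x = x" if m: "\<bar>m\<bar> < \<delta>" for m
  proof -
    \<comment> \<open>The solution of \<open>r / 2 + E * |m| = r\<close>, which makes the ball
      invariant.\<close>
    define r where "r = 2 * E * \<bar>m\<bar>"
    have r0: "r \<ge> 0" using E by (simp add: r_def)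
    have "\<bar>m\<bar> * (2 * E * (4 * E + 1)) \<le> 1"
      using m E by (simp add: \<delta>_def pos_less_divide_eq less_imp_le)
    then have half: "E * (2 * r + \<bar>m\<bar>) \<le> 1/2" by (simp add: r_def algebra_simps)
    have "2 * r + \<bar>m\<bar> \<le> E * (2 * r + \<bar>m\<bar>)"
      using mult_right_mono[of 1 E "2 * r + \<bar>m\<bar>"] E r0 by simp
    also note half
    finally have "2 * r + \<bar>m\<bar> \<le> 1/2" .
    then have r1: "r \<le> 1" "\<bar>m\<bar> \<le> 1" using r0 by linarith+
    let ?T = "S \<inter> cball x0 r"
    have L: "dist (F m x) (F m y) \<le> 1/2 * dist x y" if "x \<in> ?T" "y \<in> ?T" for x y
    proof -
      have xy: "norm (x - x0) \<le> r" "norm (y - x0) \<le> r"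
        using that by (auto simp: dist_norm norm_minus_commute)
      have "norm (F m x - F m y) \<le> C * (norm (x - x0) + norm (y - x0) + \<bar>m\<bar>) * norm (x - y)"
        using xy r1 by (intro lip) auto
      also have "\<dots> \<le> E * (r + r + \<bar>m\<bar>) * norm (x - y)"
        using xy E r0 by (intro mult_right_mono mult_mono add_mono) auto
      also have "\<dots> \<le> 1/2 * norm (x - y)"
        using half by (intro mult_right_mono) auto
      finally show ?thesis by (simp add: dist_norm)
    qed
    have "F m x \<in> ?T" if "x \<in> ?T" for x
    proof -
      have "norm (F m x - x0) \<le> norm (F m x - F m x0) + norm (F m x0 - x0)"
        by (metis diff_add_cancel add_diff_eq norm_triangle_ineq)
      also have "\<dots> \<le> 1/2 * norm (x - x0) + C * \<bar>m\<bar>"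
        using L[of x x0] that S r0 F0[of m] r1 by (auto simp: dist_norm intro!: add_mono)
      also have "\<dots> \<le> 1/2 * r + E * \<bar>m\<bar>"
        using that E by (auto simp: dist_norm norm_minus_commute intro!: add_mono mult_right_mono)
      finally show ?thesis using that F[of x m] by (auto simp: r_def dist_norm norm_minus_commute)
    qed
    then have "\<exists>!x\<in>?T. F m x = x"
      using L S r0 by (intro Banach_fix[where c = "1/2"]) (auto simp: complete_eq_closed)
    then show ?thesis by (auto simp: r_def dist_norm norm_minus_commute)
  qed
  then obtain X where "\<And>m. \<bar>m\<bar> < \<delta> \<Longrightarrow> X m \<in> S \<and> norm (X m - x0) \<le> 2 * E * \<bar>m\<bar> \<and> F m (X m) = X m"
    by metis
  then show ?thesis using \<delta> by blast
qed


text \<open>The constant is proportional to the norms of the arguments, hence small near 0; this is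
  what makes the quadratic remainder a contraction.\<close>

lemma bilinear_diag_lipschitz:
  assumes "bounded_bilinear (B :: 'a::real_normed_vector \<Rightarrow> 'a \<Rightarrow> 'b::real_normed_vector)"
  obtains K where "K \<ge> 0" "\<And>x y. norm (B x x - B y y) \<le> K * (norm x + norm y) * norm (x - y)"
proof -
  interpret bounded_bilinear B by fact
  obtain K where K: "K \<ge> 0" "\<And>x y. norm (B x y) \<le> norm x * norm y * K"
    using nonneg_bounded by auto
  have "norm (B x x - B y y) \<le> K * (norm x + norm y) * norm (x - y)" for x y
  proof -
    have "B x x - B y y = B x (x - y) + B (x - y) y" by (simp add: diff_left diff_right)
    then have "norm (B x x - B y y) \<le> norm x * norm (x - y) * K + norm (x - y) * norm y * K"
      using norm_triangle_le[OF add_mono[OF K(2) K(2)]] by metis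
    then show ?thesis by (simp add: algebra_simps)
  qed
  with K show ?thesis using that by blast
qed

text \<open>Newton form: \<open>D\<close> plays the inverse of the linearisation, so at
  \<open>m = 0\<close> only a term quadratic in \<open>x - x0\<close> remains, with small Lipschitz
  constant near \<open>x0\<close>. Every other term carries a factor \<open>m\<close>.\<close>

lemma quadratic_perturbed_fixed_point:
  fixes x0 :: "'a::banach"
  assumes D: "bounded_linear D" and L: "bounded_linear L"
    and B: "bounded_bilinear B0" "bounded_bilinear B1" "bounded_bilinear B2"
    and S: "closed S" "x0 \<in> S"
    and F_def: "\<And>m x. F m x = x0 + D (B0 (x - x0) (x - x0) + m *\<^sub>R (L x + B1 x x) + m\<^sup>2 *\<^sub>R B2 x x)"
    and F: "\<And>m x. x \<in> S \<Longrightarrow> F m x \<in> S"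
  shows "\<exists>\<delta>>0. \<exists>C X. \<forall>m. \<bar>m\<bar> < \<delta> \<longrightarrow> X m \<in> S \<and> norm (X m - x0) \<le> C * \<bar>m\<bar> \<and> F m (X m) = X m"
proof -
  interpret D: bounded_linear D by fact
  interpret L: bounded_linear L by fact
  interpret B0: bounded_bilinear B0 by fact
  obtain d where d: "d \<ge> 0" "\<And>x. norm (D x) \<le> norm x * d" using D.nonneg_bounded by auto
  obtain l where l: "l \<ge> 0" "\<And>x. norm (L x) \<le> norm x * l" using L.nonneg_bounded by auto
  obtain b0 where b0: "b0 \<ge> 0" "\<And>x y. norm (B0 x x - B0 y y) \<le> b0 * (norm x + norm y) * norm (x - y)"
    using bilinear_diag_lipschitz[OF B(1)] by metis
  obtain b1 where b1: "b1 \<ge> 0" "\<And>x y. norm (B1 x x - B1 y y) \<le> b1 * (norm x + norm y) * norm (x - y)"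
    using bilinear_diag_lipschitz[OF B(2)] by metis
  obtain b2 where b2: "b2 \<ge> 0" "\<And>x y. norm (B2 x x - B2 y y) \<le> b2 * (norm x + norm y) * norm (x - y)"
    using bilinear_diag_lipschitz[OF B(3)] by metis
  \<comment> \<open>Bounds \<open>norm x + norm y\<close> for \<open>x\<close>, \<open>y\<close> in
    the unit ball around \<open>x0\<close>.\<close>
  define R where "R = 2 * norm x0 + 2"
  have R: "R \<ge> 0" by (simp add: R_def)
  define C1 where "C1 = d * (b0 + l + b1 * R + b2 * R)"
  define C0 where "C0 = d * (norm (L x0 + B1 x0 x0) + norm (B2 x0 x0))"
  have C: "C1 \<ge> 0" "C0 \<ge> 0" using d l b0 b1 b2 R by (auto simp: C1_def C0_def)
  have m2: "m\<^sup>2 \<le> \<bar>m\<bar>" if "\<bar>m\<bar> \<le> 1" for m :: real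
    using that mult_left_mono[of "\<bar>m\<bar>" 1 "\<bar>m\<bar>"] by (simp add: power2_eq_square abs_mult_self_eq)
  have "norm (F m x0 - x0) \<le> (C0 + C1) * \<bar>m\<bar>" if m: "\<bar>m\<bar> \<le> 1" for m
  proof -
    have "norm (F m x0 - x0) \<le> norm (m *\<^sub>R (L x0 + B1 x0 x0) + m\<^sup>2 *\<^sub>R B2 x0 x0) * d"
      unfolding F_def using d by (simp add: B0.zero_left)
    also have "\<dots> \<le> (\<bar>m\<bar> * norm (L x0 + B1 x0 x0) + m\<^sup>2 * norm (B2 x0 x0)) * d"
      using d by (intro mult_right_mono norm_triangle_le add_mono) auto
    also have "\<dots> \<le> (\<bar>m\<bar> * norm (L x0 + B1 x0 x0) + \<bar>m\<bar> * norm (B2 x0 x0)) * d"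
      using d m2[OF m] by (intro mult_right_mono add_mono) auto
    also have "\<dots> = C0 * \<bar>m\<bar>" by (simp add: C0_def algebra_simps)
    also have "\<dots> \<le> (C0 + C1) * \<bar>m\<bar>" using C by (intro mult_right_mono) auto
    finally show ?thesis .
  qed
  moreover have "norm (F m x - F m y) \<le> (C0 + C1) * (norm (x - x0) + norm (y - x0) + \<bar>m\<bar>) * norm (x - y)"
    if m: "\<bar>m\<bar> \<le> 1" and x: "norm (x - x0) \<le> 1" and y: "norm (y - x0) \<le> 1" for m x y
  proof -
    let ?n = "norm (x - y)" and ?q = "norm (x - x0) + norm (y - x0)"
    have xR: "norm x + norm y \<le> R"
      using norm_triangle_sub[of x x0] norm_triangle_sub[of y x0] x y by (simp add: R_def)
    have e0: "norm (B0 (x - x0) (x - x0) - B0 (y - x0) (y - x0)) \<le> b0 * ?q * ?n"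
      using b0(2)[of "x - x0" "y - x0"] by simp
    have e1: "norm (L x - L y) \<le> l * ?n" using l(2)[of "x - y"] by (simp add: L.diff mult.commute)
    have e2: "norm (B1 x x - B1 y y) \<le> b1 * R * ?n"
      using b1(2)[of x y] by (rule order_trans) (intro mult_right_mono mult_left_mono xR b1; simp)
    have e3: "norm (B2 x x - B2 y y) \<le> b2 * R * ?n"
      using b2(2)[of x y] by (rule order_trans) (intro mult_right_mono mult_left_mono xR b2; simp)
    have "F m x - F m y = D (B0 (x - x0) (x - x0) - B0 (y - x0) (y - x0)
        + m *\<^sub>R ((L x - L y) + (B1 x x - B1 y y)) + m\<^sup>2 *\<^sub>R (B2 x x - B2 y y))"
      by (simp add: F_def D.diff[symmetric] algebra_simps)
    then have "norm (F m x - F m y) \<le> norm (B0 (x - x0) (x - x0) - B0 (y - x0) (y - x0)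
        + m *\<^sub>R ((L x - L y) + (B1 x x - B1 y y)) + m\<^sup>2 *\<^sub>R (B2 x x - B2 y y)) * d"
      using d by simp
    also have "\<dots> \<le> (b0 * ?q * ?n + \<bar>m\<bar> * (l * ?n + b1 * R * ?n) + m\<^sup>2 * (b2 * R * ?n)) * d"
      using d e0 e1 e2 e3
      by (intro mult_right_mono norm_triangle_le add_mono)
        (auto intro!: mult_left_mono norm_triangle_le add_mono)
    also have "\<dots> \<le> (b0 * ?q * ?n + \<bar>m\<bar> * (l * ?n + b1 * R * ?n) + \<bar>m\<bar> * (b2 * R * ?n)) * d"
      using d l b1 b2 R m2[OF m] by (intro mult_right_mono add_mono) auto
    also have "\<dots> = d * (b0 * ?q + (l + b1 * R + b2 * R) * \<bar>m\<bar>) * ?n" by (simp add: algebra_simps)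
    also have "\<dots> \<le> d * ((b0 + l + b1 * R + b2 * R) * (?q + \<bar>m\<bar>)) * ?n"
      using d l b0 b1 b2 R
      by (intro mult_right_mono mult_left_mono) (auto simp: algebra_simps)
    also have "\<dots> = C1 * (?q + \<bar>m\<bar>) * ?n" by (simp add: C1_def)
    also have "\<dots> \<le> (C0 + C1) * (?q + \<bar>m\<bar>) * ?n" using C by (intro mult_right_mono) auto
    finally show ?thesis .
  qed
  ultimately show ?thesis using S F by (intro perturbed_fixed_point[where C = "C0 + C1"]) auto
qed

section \<open>Correlation with a kernel\<close>

instance bcontfun :: (metric_space, banach) banach ..

definition bmult :: "('a::topological_space \<Rightarrow>\<^sub>C real) \<Rightarrow> ('a \<Rightarrow>\<^sub>C real) \<Rightarrow> ('a \<Rightarrow>\<^sub>C real)" where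
  "bmult f g = Bcontfun (\<lambda>x. f x * g x)"

lemma abs_apply_le_norm: "\<bar>apply_bcontfun f x\<bar> \<le> norm f"
  using norm_bounded[of f x] by simp

lemma bmult_apply [simp]: "bmult f g x = f x * g x"
proof -
  have "(\<lambda>x. f x * g x) \<in> bcontfun"
    by (rule bcontfun_normI[where b = "norm f * norm g"])
      (auto simp: abs_mult intro!: continuous_intros mult_mono abs_apply_le_norm)
  then show ?thesis by (simp add: bmult_def Bcontfun_inverse)
qed

lemma bounded_bilinear_bmult: "bounded_bilinear bmult"
proof
  show "\<exists>K. \<forall>f g. norm (bmult f g) \<le> norm f * norm g * K"
    by (rule exI[of _ 1])
      (auto simp: abs_mult intro!: norm_bound mult_mono abs_apply_le_norm)
qed (auto intro!: bcontfun_eqI simp: algebra_simps)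

lemma bounded_linear_apply_bcontfun: "bounded_linear (\<lambda>f. apply_bcontfun f x)"
  by (rule bounded_linear_intro[of _ 1])
    (auto simp: norm_bounded)

text \<open>The shift is put on \<open>M\<close>, so \<open>K\<close> is needed only on one period
  and may fail to close up there; derivatives in \<open>s\<close> and in \<open>t\<close> agree on
  \<open>M (s + t)\<close>, which allows integration by parts.\<close>

definition corr :: "(real \<Rightarrow> real) \<Rightarrow> (real \<Rightarrow>\<^sub>C real) \<Rightarrow> (real \<Rightarrow>\<^sub>C real)" where
  "corr K M = Bcontfun (\<lambda>s. integral {0..2*pi} (\<lambda>t. K t * M (s + t)))"

lemma integrable_corr:
  fixes K :: "real \<Rightarrow> real"
  assumes "continuous_on UNIV K"
  shows "(\<lambda>t. K t * apply_bcontfun M (s + t)) integrable_on {a..b}"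
proof (rule integrable_continuous_real)
  show "continuous_on {a..b} (\<lambda>t. K t * apply_bcontfun M (s + t))"
    by (auto intro!: continuous_intros continuous_on_compose2[OF continuous_on_apply_bcontfun[of UNIV]]
      continuous_on_subset[OF assms])
qed

lemma norm_corr_integral_le:
  assumes "\<And>t. t \<in> {0..2*pi} \<Longrightarrow> \<bar>K t\<bar> \<le> B" "continuous_on UNIV K"
  shows "\<bar>integral {0..2*pi} (\<lambda>t. K t * apply_bcontfun M (s + t))\<bar> \<le> norm M * (B * (2*pi))"
proof -
  have "B \<ge> 0" using assms(1)[of 0] by auto
  then have "norm (integral (cbox 0 (2*pi)) (\<lambda>t. K t * apply_bcontfun M (s + t))) \<le> B * norm M * measure lborel (cbox 0 (2*pi))"
    using assms integrable_corr[OF assms(2), of M s 0 "2*pi"]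
    by (intro integrable_bound) (auto simp: abs_mult intro!: mult_mono abs_apply_le_norm)
  then show ?thesis by (simp add: mult_ac)
qed

lemma kernel_bound:
  assumes "continuous_on UNIV (K :: real \<Rightarrow> real)"
  obtains B where "\<And>t. t \<in> {0..2*pi} \<Longrightarrow> \<bar>K t\<bar> \<le> B"
proof -
  have "compact (K ` {0..2*pi})"
    by (intro compact_continuous_image continuous_on_subset[OF assms]) auto
  from compact_imp_bounded[OF this] show ?thesis
    using that by (auto simp: bounded_iff simp del: atLeastAtMost_iff)
qed

lemma corr_apply:
  assumes K: "continuous_on UNIV K"
  shows "corr K M s = integral {0..2*pi} (\<lambda>t. K t * M (s + t))"
proof -
  obtain B where B: "\<And>t. t \<in> {0..2*pi} \<Longrightarrow> \<bar>K t\<bar> \<le> B" using kernel_bound[OF K] by blast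
  have "continuous_on UNIV (\<lambda>s. integral (cbox 0 (2*pi)) (\<lambda>t. K t * apply_bcontfun M (s + t)))"
    by (intro integral_continuous_on_param)
      (auto simp: split_beta intro!: continuous_intros
        continuous_on_compose2[OF continuous_on_apply_bcontfun[of UNIV]] continuous_on_compose2[OF K])
  then have "(\<lambda>s. integral {0..2*pi} (\<lambda>t. K t * apply_bcontfun M (s + t))) \<in> bcontfun"
    using norm_corr_integral_le[OF B K] by (intro bcontfun_normI) auto
  then show ?thesis by (simp add: corr_def Bcontfun_inverse)
qed

lemma bounded_linear_corr:
  assumes K: "continuous_on UNIV K"
  shows "bounded_linear (corr K)"
proof -
  obtain B where B: "\<And>t. t \<in> {0..2*pi} \<Longrightarrow> \<bar>K t\<bar> \<le> B" using kernel_bound[OF K] by blast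
  show ?thesis
  proof (rule bounded_linear_intro[where K = "B * (2*pi)"])
    show "corr K (M + N) = corr K M + corr K N" for M N
      by (rule bcontfun_eqI)
        (simp add: corr_apply[OF K] distrib_left integral_add integrable_corr[OF K])
    show "corr K (r *\<^sub>R M) = r *\<^sub>R corr K M" for r M
      by (rule bcontfun_eqI) (simp add: corr_apply[OF K] mult.left_commute)
    show "norm (corr K M) \<le> norm M * (B * (2*pi))" for M
      using norm_corr_integral_le[OF B K] by (intro norm_bound) (simp add: corr_apply[OF K])
  qed
qed

lemma corr_kernel_add:
  assumes "continuous_on UNIV K" "continuous_on UNIV L"
  shows "corr (\<lambda>t. K t + L t) M s = corr K M s + corr L M s"
  using assms by (simp add: corr_apply continuous_on_add distrib_right integral_add integrable_corr)

lemma corr_kernel_mult: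
  assumes "continuous_on UNIV K"
  shows "corr (\<lambda>t. c * K t) M s = c * corr K M s"
  using assms by (simp add: corr_apply continuous_on_mult_left mult.assoc)

section \<open>Periodic functions and differentiation of correlations\<close>

text \<open>A subset rather than a type of its own: the contraction argument asks only for a closed
  set that the iteration preserves.\<close>

definition per :: "(real \<Rightarrow>\<^sub>C real) set" where
  "per = {M. \<forall>s. apply_bcontfun M (s + 2*pi) = apply_bcontfun M s}"

lemma closed_per: "closed per"
proof -
  have "per = (\<Inter>s. {M. apply_bcontfun M (s + 2*pi) = apply_bcontfun M s})"
    by (auto simp: per_def)
  also have "closed \<dots>"
    by (intro closed_INT ballI closed_Collect_eq linear_continuous_on bounded_linear_apply_bcontfun)
  finally show ?thesis .
qed

lemma corr_per:
  assumes "continuous_on UNIV K" "M \<in> per"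
  shows "corr K M \<in> per"
proof -
  have "apply_bcontfun M (s + 2*pi + t) = apply_bcontfun M (s + t)" for s t
    using assms(2) by (auto simp: per_def add_ac dest: spec[of _ "s + t"])
  then show ?thesis by (simp add: per_def corr_apply[OF assms(1)])
qed

lemma bmult_per: "f \<in> per \<Longrightarrow> g \<in> per \<Longrightarrow> bmult f g \<in> per"
  by (simp add: per_def)

text \<open>Integration by parts moves the derivative from the merely continuous \<open>M\<close> to the kernel.\<close>

lemma corr_has_derivative:
  assumes K: "\<And>t. (K has_real_derivative K' t) (at t)" and K': "continuous_on UNIV K'" and M: "M \<in> per"
  shows "((corr K M) has_real_derivative (K (2*pi) - K 0) * M s - corr K' M s) (at s)"
proof -
  have cK: "continuous_on UNIV K"
    using K by (meson DERIV_isCont continuous_at_imp_continuous_on)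
  have cM: "isCont (apply_bcontfun M) x" for x
    using continuous_on_apply_bcontfun[of UNIV M] by (simp add: continuous_on_eq_continuous_at del: continuous_on_apply_bcontfun)
  obtain A where A: "\<And>x. (A has_real_derivative apply_bcontfun M x) (at x)"
    using einterval_antiderivative[of "-\<infinity>" "\<infinity>" "apply_bcontfun M"] cM
    by (auto simp: has_real_derivative_iff_has_vector_derivative)
  have cA: "continuous_on T A" for T
    using A by (meson DERIV_isCont continuous_at_imp_continuous_on)
  have A': "((\<lambda>u. A (u + t)) has_real_derivative apply_bcontfun M (u + t)) (at u within T)" for u t T
    by (rule DERIV_chain2[OF A, of "\<lambda>u. u + t" 1, simplified]) (auto intro!: derivative_eq_intros)
  have A'': "((\<lambda>t. A (u + t)) has_real_derivative apply_bcontfun M (u + t)) (at t within T)" for u t T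
    by (rule DERIV_chain2[OF A, of "\<lambda>t. u + t" 1, simplified]) (auto intro!: derivative_eq_intros)
  have int: "(\<lambda>t. K' t * A (u + t)) integrable_on {0..2*pi}" for u
    using continuous_on_subset[OF K']
    by (intro integrable_continuous_real continuous_intros continuous_on_compose2[OF cA[of UNIV]]) auto
  \<comment> \<open>On the right, \<open>u\<close> enters only through the differentiable
    \<open>A\<close>, so the whole expression can be differentiated, the integral by the Leibniz
    rule.\<close>
  have parts: "corr K M u = K (2*pi) * A (u + 2*pi) - K 0 * A u - integral {0..2*pi} (\<lambda>t. K' t * A (u + t))" for u
  proof -
    have "((\<lambda>t. K' t * A (u + t) + K t * apply_bcontfun M (u + t)) has_integral
        K (2*pi) * A (u + 2*pi) - K 0 * A (u + 0)) {0..2*pi}"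
      by (intro fundamental_theorem_of_calculus)
        (auto simp: has_real_derivative_iff_has_vector_derivative[symmetric]
          intro!: derivative_eq_intros A'' has_field_derivative_at_within[OF K])
    from has_integral_diff[OF this integrable_integral[OF int[of u]]]
    have "((\<lambda>t. K t * apply_bcontfun M (u + t)) has_integral
       K (2*pi) * A (u + 2*pi) - K 0 * A u - integral {0..2*pi} (\<lambda>t. K' t * A (u + t))) {0..2*pi}"
      by simp
    then show ?thesis by (simp add: corr_apply[OF cK] integral_unique)
  qed
  have "((\<lambda>u. integral (cbox 0 (2*pi)) (\<lambda>t. K' t * A (u + t))) has_field_derivative
      integral (cbox 0 (2*pi)) (\<lambda>t. K' t * apply_bcontfun M (s + t))) (at s within UNIV)"
  proof (intro leibniz_rule_field_derivative)
    show "continuous_on (UNIV \<times> cbox 0 (2*pi)) (\<lambda>(u, t). K' t * apply_bcontfun M (u + t))"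
      by (auto simp: split_beta intro!: continuous_intros
        continuous_on_compose2[OF continuous_on_apply_bcontfun[of UNIV]] continuous_on_compose2[OF K'])
  qed (use int in \<open>auto intro!: derivative_eq_intros A'\<close>)
  then have I: "((\<lambda>u. integral {0..2*pi} (\<lambda>t. K' t * A (u + t))) has_field_derivative corr K' M s) (at s)"
    by (simp add: corr_apply[OF K'])
  have "((\<lambda>u. K (2*pi) * A (u + 2*pi) - K 0 * A u - integral {0..2*pi} (\<lambda>t. K' t * A (u + t))) has_real_derivative
      K (2*pi) * M (s + 2*pi) - K 0 * M s - corr K' M s) (at s)"
    by (intro derivative_intros DERIV_cmult A' A I)
  \<comment> \<open>Periodicity merges the two boundary terms into one multiple of
    \<open>M s\<close>.\<close>
  moreover have "M (s + 2*pi) = M s" using M by (simp add: per_def)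
  ultimately show ?thesis unfolding parts[abs_def] by (simp add: algebra_simps)
qed

section \<open>First Fourier coefficients\<close>

text \<open>Written through \<open>corr\<close> at 0 so that bounded linearity is inherited.\<close>

definition cosc :: "(real \<Rightarrow>\<^sub>C real) \<Rightarrow> real" where "cosc M = corr cos M 0 / pi"
definition sinc :: "(real \<Rightarrow>\<^sub>C real) \<Rightarrow> real" where "sinc M = corr sin M 0 / pi"

text \<open>The pair \<open>corr cos M\<close>, \<open>corr sin M\<close> solves the rotation system
  \<open>c' = s\<close>, \<open>s' = - c\<close>. Rotating it back gives the constants
  \<open>?f\<close> and \<open>?g\<close>, read off at 0.\<close>

lemma corr_cos:
  assumes "M \<in> per"
  shows "corr cos M s = pi * (cosc M * cos s + sinc M * sin s)"
proof -
  have cont: "continuous_on UNIV (sin :: real \<Rightarrow> real)" "continuous_on UNIV (cos :: real \<Rightarrow> real)" "continuous_on UNIV (\<lambda>t. - sin t :: real)"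
    by (auto intro!: continuous_intros)
  have c: "((corr cos M) has_real_derivative corr sin M s) (at s)" for s
    using corr_has_derivative[of cos "\<lambda>t. - sin t" M s] corr_kernel_mult[of sin "-1" M s] assms cont
    by (auto intro!: derivative_eq_intros)
  have s: "((corr sin M) has_real_derivative - corr cos M s) (at s)" for s
    using corr_has_derivative[of sin cos M s] assms cont
    by (auto intro!: derivative_eq_intros)
  let ?f = "\<lambda>s. cos s * corr cos M s - sin s * corr sin M s"
  let ?g = "\<lambda>s. sin s * corr cos M s + cos s * corr sin M s"
  have "?f s = ?f 0" "?g s = ?g 0"
    by (rule DERIV_isconst_all; auto intro!: derivative_eq_intros c s simp: algebra_simps)+
  then have "?f s = pi * cosc M" "?g s = pi * sinc M" by (auto simp: cosc_def sinc_def)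
  moreover have "cos s * ?f s + sin s * ?g s = corr cos M s"
  proof -
    have "cos s * ?f s + sin s * ?g s = (cos s * cos s + sin s * sin s) * corr cos M s" by algebra
    also have "\<dots> = corr cos M s" by (simp only: sin_cos_squared_add3 mult_1)
    finally show ?thesis .
  qed
  ultimately show ?thesis by (simp add: algebra_simps)
qed

section \<open>Harmonics and periodic Green's functions\<close>

lemma has_integral_cos_multiple:
  "((\<lambda>t. cos (real m * t)) has_integral (if m = 0 then 2*pi else 0)) {0..2*pi}"
proof (cases "m = 0")
  case True
  then show ?thesis using has_integral_const_real[of "1::real" 0 "2*pi"] by simp
next
  case False
  have "((\<lambda>t. cos (real m * t)) has_integral sin (real m * (2*pi)) / m - sin (real m * 0) / m) {0..2*pi}"
    using False by (intro fundamental_theorem_of_calculus)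
      (auto simp: has_real_derivative_iff_has_vector_derivative[symmetric] intro!: derivative_eq_intros)
  then show ?thesis using False sin_npi[of "2*m"] by (simp add: mult_ac)
qed

lemma has_integral_sin_multiple: "((\<lambda>t. sin (real m * t)) has_integral 0) {0..2*pi}"
proof (cases "m = 0")
  case False
  have "((\<lambda>t. sin (real m * t)) has_integral - cos (real m * (2*pi)) / m - (- cos (real m * 0) / m)) {0..2*pi}"
    using False by (intro fundamental_theorem_of_calculus)
      (auto simp: has_real_derivative_iff_has_vector_derivative[symmetric] intro!: derivative_eq_intros)
  then show ?thesis using False cos_npi[of "2*m"] by (simp add: mult_ac)
qed simp

definition cosb :: "nat \<Rightarrow> (real \<Rightarrow>\<^sub>C real)" where "cosb n = Bcontfun (\<lambda>s. cos (real n * s))"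
definition sinb :: "nat \<Rightarrow> (real \<Rightarrow>\<^sub>C real)" where "sinb n = Bcontfun (\<lambda>s. sin (real n * s))"

lemma cosb_apply [simp]: "cosb n s = cos (real n * s)"
proof -
  have "(\<lambda>s. cos (real n * s)) \<in> bcontfun"
    by (rule bcontfun_normI[where b = 1]) (auto intro!: continuous_intros)
  then show ?thesis by (simp add: cosb_def Bcontfun_inverse)
qed

lemma sinb_apply [simp]: "sinb n s = sin (real n * s)"
proof -
  have "(\<lambda>s. sin (real n * s)) \<in> bcontfun"
    by (rule bcontfun_normI[where b = 1]) (auto intro!: continuous_intros)
  then show ?thesis by (simp add: sinb_def Bcontfun_inverse)
qed

lemma cosb_per: "cosb n \<in> per" and sinb_per: "sinb n \<in> per"
  using cos_npi[of "2*n"] sin_npi[of "2*n"]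
  by (auto simp: per_def distrib_left cos_add sin_add mult_ac)

lemma cont_trig: "continuous_on UNIV (sin :: real \<Rightarrow> real)" "continuous_on UNIV (cos :: real \<Rightarrow> real)"
  by (auto intro!: continuous_intros)

text \<open>Product-to-sum formulas leave the frequencies \<open>m\<close> and \<open>m + 2\<close>;
  indexing by \<open>Suc m\<close> keeps the difference frequency a natural number.\<close>

lemma coeff_harmonics [simp]:
  "cosc (cosb (Suc m)) = (if m = 0 then 1 else 0)"
  "cosc (sinb (Suc m)) = 0"
  "sinc (cosb (Suc m)) = 0"
  "sinc (sinb (Suc m)) = (if m = 0 then 1 else 0)"
proof -
  note [simp] = cosc_def sinc_def corr_apply cont_trig
  let ?C = "\<lambda>m t. cos (real m * t)" and ?S = "\<lambda>m t. sin (real m * t)"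
  note C = has_integral_cos_multiple and S = has_integral_sin_multiple
  have "(\<lambda>t. cos t * ?C (Suc m) t) = (\<lambda>t. (?C m t + ?C (m + 2) t) / 2)"
    by (auto simp: cos_times_cos algebra_simps intro!: ext)
  then show "cosc (cosb (Suc m)) = (if m = 0 then 1 else 0)"
    using has_integral_divide[OF has_integral_add[OF C[of m] C[of "m + 2"]], of 2]
    by (auto simp del: of_nat_Suc dest: integral_unique)
  have "(\<lambda>t. cos t * ?S (Suc m) t) = (\<lambda>t. (?S (m + 2) t + ?S m t) / 2)"
    by (rule ext) (simp add: cos_times_sin algebra_simps)
  then show "cosc (sinb (Suc m)) = 0"
    using has_integral_divide[OF has_integral_add[OF S[of "m + 2"] S[of m]], of 2]
    by (auto simp del: of_nat_Suc dest: integral_unique)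
  have "(\<lambda>t. sin t * ?C (Suc m) t) = (\<lambda>t. (?S (m + 2) t - ?S m t) / 2)"
    by (rule ext) (simp add: sin_times_cos algebra_simps)
  then show "sinc (cosb (Suc m)) = 0"
    using has_integral_divide[OF has_integral_diff[OF S[of "m + 2"] S[of m]], of 2]
    by (auto simp del: of_nat_Suc dest: integral_unique)
  have "(\<lambda>t. sin t * ?S (Suc m) t) = (\<lambda>t. (?C m t - ?C (m + 2) t) / 2)"
    by (auto simp: sin_times_sin algebra_simps intro!: ext)
  then show "sinc (sinb (Suc m)) = (if m = 0 then 1 else 0)"
    using has_integral_divide[OF has_integral_diff[OF C[of m] C[of "m + 2"]], of 2]
    by (auto simp del: of_nat_Suc dest: integral_unique)
qed

lemma bounded_linear_cosc: "bounded_linear cosc" and bounded_linear_sinc: "bounded_linear sinc"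
  unfolding cosc_def[abs_def] sinc_def[abs_def]
  by (intro bounded_linear_divide[THEN bounded_linear_compose] bounded_linear_compose[OF bounded_linear_apply_bcontfun] bounded_linear_corr cont_trig)+

definition proj :: "(real \<Rightarrow>\<^sub>C real) \<Rightarrow> (real \<Rightarrow>\<^sub>C real)" where
  "proj M = cosc M *\<^sub>R cosb 1 + sinc M *\<^sub>R sinb 1"

lemma proj_apply: "proj M s = cosc M * cos s + sinc M * sin s"
  by (simp add: proj_def)

lemma bounded_linear_proj: "bounded_linear proj"
  unfolding proj_def[abs_def]
  by (intro bounded_linear_add bounded_linear_scaleR_const bounded_linear_cosc bounded_linear_sinc)

lemma per_intros:
  "M \<in> per \<Longrightarrow> N \<in> per \<Longrightarrow> M + N \<in> per"
  "M \<in> per \<Longrightarrow> N \<in> per \<Longrightarrow> M - N \<in> per"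
  "M \<in> per \<Longrightarrow> c *\<^sub>R M \<in> per"
  by (simp_all add: per_def)

lemma proj_per: "proj M \<in> per"
  by (simp add: proj_def per_intros cosb_per sinb_per)

text \<open>Correlation with such a \<open>K\<close> solves \<open>h'' + j\<^sup>2 h = M - proj M\<close> periodically; the cosine term
  is what removes the first harmonic \<open>proj M\<close>.\<close>

definition green_kernel :: "real \<Rightarrow> (real \<Rightarrow> real) \<Rightarrow> (real \<Rightarrow> real) \<Rightarrow> bool" where
  "green_kernel j K K' \<longleftrightarrow>
     (\<forall>t. (K has_real_derivative K' t) (at t)) \<and>
     (\<forall>t. (K' has_real_derivative (- 1 / pi) * cos t + (- j\<^sup>2) * K t) (at t)) \<and>
     K (2*pi) = K 0 \<and> K' (2*pi) - K' 0 = -1"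

lemma green_kernel_continuous:
  assumes "green_kernel j K K'"
  shows "continuous_on UNIV K" "continuous_on UNIV K'"
  using assms unfolding green_kernel_def
  by (meson DERIV_isCont continuous_at_imp_continuous_on)+

text \<open>Each differentiation moves to the kernel with a minus sign. The jump -1 of
  \<open>K'\<close> produces \<open>M\<close>, and the cosine forcing produces \<open>proj M\<close>
  by \<open>corr_cos\<close>.\<close>

lemma green_kernel_solves:
  assumes K: "green_kernel j K K'" and M: "M \<in> per"
  shows "((corr K M) has_real_derivative - corr K' M s) (at s)"
    and "((corr K' M) has_real_derivative - (M s - proj M s - j\<^sup>2 * corr K M s)) (at s)"
proof -
  note c = green_kernel_continuous[OF K]
  have c2: "continuous_on UNIV (\<lambda>t. (- 1 / pi) * cos t + (- j\<^sup>2) * K t)"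
    by (intro continuous_intros c)
  have "corr (\<lambda>t. (- 1 / pi) * cos t + (- j\<^sup>2) * K t) M s = - proj M s - j\<^sup>2 * corr K M s"
    unfolding corr_kernel_add[OF continuous_on_mult_left[OF cont_trig(2)] continuous_on_mult_left[OF c(1)]]
      corr_kernel_mult[OF cont_trig(2)] corr_kernel_mult[OF c(1)]
    by (simp add: corr_cos[OF M] proj_apply)
  moreover have "((corr K' M) has_real_derivative
      (K' (2*pi) - K' 0) * M s - corr (\<lambda>t. (- 1 / pi) * cos t + (- j\<^sup>2) * K t) M s) (at s)"
    using corr_has_derivative[OF _ c2 M, of K' s] K unfolding green_kernel_def by blast
  moreover have "K' (2*pi) - K' 0 = -1" using K by (simp add: green_kernel_def)
  ultimately show "((corr K' M) has_real_derivative - (M s - proj M s - j\<^sup>2 * corr K M s)) (at s)"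
    by (auto elim!: DERIV_cong)
  show "((corr K M) has_real_derivative - corr K' M s) (at s)"
    using corr_has_derivative[OF _ c(2) M, of K s] K by (simp add: green_kernel_def)
qed

text \<open>At resonance the kernel is the secular solution of
  \<open>K'' + K = - cos t / pi\<close>: the growth of \<open>t - pi\<close> over a period gives the
  jump -1 of \<open>K'\<close>, and \<open>sin\<close> vanishes at both ends.\<close>

lemma green_kernel_1:
  "green_kernel 1 (\<lambda>t. - ((t - pi) * sin t) / (2*pi)) (\<lambda>t. - (sin t + (t - pi) * cos t) / (2*pi))"
  unfolding green_kernel_def
  by (auto intro!: derivative_eq_intros simp: field_simps)

text \<open>The homogeneous solution \<open>cos (k * (t - pi))\<close> is even about
  \<open>pi\<close>, so its end values agree; \<open>A\<close> normalises its derivative jump to -1,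
  and \<open>B * cos t\<close> answers the cosine forcing. Both denominators are nonzero because
  \<open>0 < k < 1\<close>.\<close>

lemma ex_green_kernel_lt_1:
  assumes k: "0 < k" "k < 1"
  shows "\<exists>K K'. green_kernel k K K'"
proof -
  have s: "sin (k * pi) \<noteq> 0" using k sin_gt_zero[of "k * pi"] by auto
  have "k * k < 1 * 1" using k by (intro mult_strict_mono) auto
  then have k2: "1 - k\<^sup>2 \<noteq> 0" by (simp add: power2_eq_square)
  define A where "A = 1 / (2 * k * sin (k * pi))"
  define B where "B = 1 / (pi * (1 - k\<^sup>2))"
  have A: "2 * (A * k * sin (k * pi)) = 1" using k s by (simp add: A_def)
  have "B * (1 - k\<^sup>2) = 1 / pi" using k2 by (simp add: B_def)
  then have B: "B = 1 / pi + B * k\<^sup>2" by (simp add: algebra_simps)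
  have *: "k * (2 * pi - pi) = k * pi" "k * (0 - pi) = - (k * pi)" by (simp_all add: algebra_simps)
  have e: "- (A * k * (cos x * k)) - B * cos t = (- 1 / pi) * cos t + (- k\<^sup>2) * (A * cos x + B * cos t)" for x t
    by (subst (1) B) (simp add: algebra_simps power2_eq_square)
  have "green_kernel k (\<lambda>t. A * cos (k * (t - pi)) + B * cos t)
      (\<lambda>t. - (A * k * sin (k * (t - pi))) - B * sin t)"
    unfolding green_kernel_def
  proof (intro conjI allI)
    fix t
    show "((\<lambda>t. A * cos (k * (t - pi)) + B * cos t) has_real_derivative
        - (A * k * sin (k * (t - pi))) - B * sin t) (at t)"
      by (auto intro!: derivative_eq_intros)
    have "((\<lambda>t. - (A * k * sin (k * (t - pi))) - B * sin t) has_real_derivative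
        - (A * k * (cos (k * (t - pi)) * k)) - B * cos t) (at t)"
      by (auto intro!: derivative_eq_intros)
    then show "((\<lambda>t. - (A * k * sin (k * (t - pi))) - B * sin t) has_real_derivative
       (- 1 / pi) * cos t + (- k\<^sup>2) * (A * cos (k * (t - pi)) + B * cos t)) (at t)"
      by (simp only: e)
  qed (use A in \<open>simp_all add: *\<close>)
  then show ?thesis by blast
qed

section \<open>The linearisation at the unperturbed solution\<close>

lemma omega2_pos: "omega2 > 0" and omega2_sq: "omega2\<^sup>2 = 2 + sqrt 2"
  by (simp_all add: omega2_def add_pos_nonneg)

text \<open>Found by solving the linearised equation for \<open>h\<close> harmonic by harmonic. With
  \<open>a = cosc h\<close> and \<open>b = sinc h\<close>, the first harmonic gives
  \<open>sinc f = - (3/2) * omega2 * a\<close> and \<open>cosc f = - (1/2) * omega2 * b\<close>;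
  these nonzero factors are the nondegeneracy of the bifurcation. The third harmonics come from
  \<open>sin s * cos s\<close> times \<open>proj h\<close>.\<close>

definition dinv :: "(real \<Rightarrow>\<^sub>C real) \<Rightarrow> (real \<Rightarrow>\<^sub>C real)" where
  "dinv f = f - proj f - (2 / (3 * omega2) * sinc f) *\<^sub>R (cosb 1 + omega2 *\<^sub>R sinb 3)
     - (2 / omega2 * cosc f) *\<^sub>R (sinb 1 - omega2 *\<^sub>R cosb 3)"

lemma bounded_linear_dinv: "bounded_linear dinv"
  unfolding dinv_def[abs_def]
  by (intro bounded_linear_sub bounded_linear_ident bounded_linear_proj bounded_linear_scaleR_const
     bounded_linear_const_mult bounded_linear_cosc bounded_linear_sinc)

lemma dinv_per: "f \<in> per \<Longrightarrow> dinv f \<in> per"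
  by (simp add: dinv_def per_intros cosb_per sinb_per proj_per)

text \<open>The sine is the bifurcation solution \<open>\<theta>1 = 4 \<surd>2 omega2 sin s\<close>, written for \<open>y = 2 \<surd>2 \<theta>1\<close>; the third
  harmonic is the remaining part of \<open>N\<close> along it.\<close>

definition M0 :: "real \<Rightarrow>\<^sub>C real" where
  "M0 = (16 * omega2) *\<^sub>R sinb 1 - (8 * omega2\<^sup>2) *\<^sub>R cosb 3"

lemma coeff_harmonics_1_3 [simp]:
  "cosc (cosb 1) = 1" "cosc (sinb 1) = 0" "sinc (cosb 1) = 0" "sinc (sinb 1) = 1"
  "cosc (cosb 3) = 0" "cosc (sinb 3) = 0" "sinc (cosb 3) = 0" "sinc (sinb 3) = 0"
  using coeff_harmonics[of 0] coeff_harmonics[of 2] by (simp_all add: numeral_3_eq_3)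

lemmas coeff_linear =
  bounded_linear_cosc[THEN bounded_linear.linear, THEN linear_add]
  bounded_linear_cosc[THEN bounded_linear.linear, THEN linear_diff]
  bounded_linear_cosc[THEN bounded_linear.linear, THEN linear_scale]
  bounded_linear_sinc[THEN bounded_linear.linear, THEN linear_add]
  bounded_linear_sinc[THEN bounded_linear.linear, THEN linear_diff]
  bounded_linear_sinc[THEN bounded_linear.linear, THEN linear_scale]

lemma coeff_M0: "cosc M0 = 0" "sinc M0 = 16 * omega2"
  using coeff_harmonics_1_3 by (simp_all add: M0_def coeff_linear)

lemma coeff_dinv: "cosc (dinv f) = - 2 / (3 * omega2) * sinc f" "sinc (dinv f) = - 2 / omega2 * cosc f"
  using coeff_harmonics_1_3 by (simp_all add: dinv_def proj_def coeff_linear)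

text \<open>\<open>dinv\<close> is the right inverse of the linearisation of \<open>M \<mapsto> M - P M - N(M)\<close> at \<open>M0\<close> for
  \<open>m = 0\<close>, and \<open>f\<close> collects the terms left over. Here \<open>u\<close> and \<open>w\<close> stand for the
  \<open>m\<close>-dependent parts of \<open>y + z\<close> and \<open>y' - z'\<close>.\<close>

lemma fixed_point_solves:
  assumes M: "M = M0 + dinv f"
    and f: "f s = (proj (M - M0) s)\<^sup>2 / 8 * cos s - omega2 / 2 * w + proj M s * u / 4 * cos s + u\<^sup>2 / 8 * cos s"
  shows "M s - proj M s =
    omega2 * (cosc M * sin s - sinc M * cos s - w) / 2 + (proj M s + u)\<^sup>2 / 8 * cos s"
proof -
  note w0 = omega2_pos[THEN less_imp_neq, symmetric]
  define a where "a = cosc (dinv f)"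
  define b where "b = sinc (dinv f)"
  have ab: "sinc f = - (3 / 2 * omega2 * a)" "cosc f = - (omega2 / 2 * b)"
    using w0 by (simp_all add: a_def b_def coeff_dinv)
  have cM: "cosc M = a" "sinc M = 16 * omega2 + b"
    by (simp_all add: M coeff_linear coeff_M0 a_def b_def)
  have h: "proj (M - M0) s = a * cos s + b * sin s"
    by (simp add: M proj_apply a_def b_def)
  have p: "(cos s)\<^sup>2 = 1 - (sin s)\<^sup>2" by (rule cos_squared_eq)
  have s3: "sin (3 * s) = 3 * sin s - 4 * sin s ^ 3"
    using sin_add[of "2 * s" s] p unfolding sin_double cos_double by simp algebra
  have c3: "cos (3 * s) = 4 * cos s ^ 3 - 3 * cos s"
    by (rule cos_treble_cos)
  have "M s = 16 * omega2 * sin s - 8 * omega2\<^sup>2 * cos (3 * s)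
      + (f s - (cosc f * cos s + sinc f * sin s) + a * (cos s + omega2 * sin (3 * s))
      + b * (sin s - omega2 * cos (3 * s)))"
    using w0 by (simp add: M M0_def dinv_def proj_apply ab)
  then have Ms: "M s - proj M s = f s + omega2 / 2 * b * cos s + 3 / 2 * omega2 * a * sin s
     + a * omega2 * (3 * sin s - 4 * sin s ^ 3) - b * omega2 * (4 * cos s ^ 3 - 3 * cos s)
     - 8 * omega2\<^sup>2 * (4 * cos s ^ 3 - 3 * cos s)"
    unfolding proj_apply cM ab s3 c3 by (simp add: algebra_simps)
  \<comment> \<open>The added term is zero by Pythagoras. Its coefficient is chosen to make the
    equation a polynomial identity in \<open>sin s\<close> and \<open>cos s\<close>, so the
    Pythagorean simp rules are switched off.\<close>
  have "M s - proj M s + (4 * omega2 * (a * sin s + b * cos s) + 32 * omega2\<^sup>2 * cos s) * ((cos s)\<^sup>2 + (sin s)\<^sup>2 - 1) =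
    omega2 * (cosc M * sin s - sinc M * cos s - w) / 2 + (proj M s + u)\<^sup>2 / 8 * cos s"
    unfolding Ms f h unfolding proj_apply cM
    by (simp add: field_simps power2_eq_square power3_eq_cube
      del: sin_cos_squared_add sin_cos_squared_add2 sin_cos_squared_add3)
  then show ?thesis by simp
qed

section \<open>Periodic solutions\<close>

text \<open>The ratio of the normal frequencies \<open>sqrt (2 - sqrt 2)\<close> and
  \<open>sqrt (2 + sqrt 2)\<close>; lying strictly between 0 and 1, it keeps the mode
  \<open>z\<close> off resonance.\<close>

definition slow_freq :: real where "slow_freq = sqrt 2 - 1"

lemma slow_freq: "0 < slow_freq" "slow_freq < 1" "slow_freq\<^sup>2 * omega2\<^sup>2 = 2 - sqrt 2"
proof -
  have "sqrt 2 < sqrt (2\<^sup>2)" by (subst real_sqrt_less_iff) simp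
  then show "0 < slow_freq" "slow_freq < 1" by (simp_all add: slow_freq_def)
  have "sqrt 2 * sqrt 2 = (2::real)" by simp
  then show "slow_freq\<^sup>2 * omega2\<^sup>2 = 2 - sqrt 2"
    unfolding omega2_sq slow_freq_def by (simp add: power2_eq_square algebra_simps)
qed

lemma ex_fixed_points:
  assumes cont: "continuous_on UNIV K" "continuous_on UNIV L" "continuous_on UNIV K'" "continuous_on UNIV L'"
  shows "\<exists>\<delta>>0. \<exists>C X. \<forall>m. \<bar>m\<bar> < \<delta> \<longrightarrow> X m \<in> per \<and> norm (X m - M0) \<le> C * \<bar>m\<bar> \<and>
    (\<forall>s. X m s - proj (X m) s =
      omega2 * (cosc (X m) * sin s - sinc (X m) * cos s - m * (corr L' (X m) s - corr K' (X m) s)) / 2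
      + (proj (X m) s + m * (corr K (X m) s + corr L (X m) s))\<^sup>2 / 8 * cos s)"
proof -
  define u where "u M = corr K M + corr L M" for M
  define w where "w M = corr L' M - corr K' M" for M
  have u: "bounded_linear u" and w: "bounded_linear w"
    unfolding u_def[abs_def] w_def[abs_def]
    by (intro bounded_linear_add bounded_linear_sub bounded_linear_corr cont)+
  have mulcos: "bounded_linear (\<lambda>x. c *\<^sub>R bmult (cosb 1) (g x))" if "bounded_linear g" for c g
    using bounded_bilinear.bounded_linear_right[OF bounded_bilinear_bmult] that
    by (intro bounded_linear_const_scaleR) (rule bounded_linear_compose)
  define B0 where "B0 x y = bmult ((1/8) *\<^sub>R bmult (cosb 1) (proj x)) (proj y)" for x y
  \<comment> \<open>Expanding \<open>(proj M + m * u)\<^sup>2 / 8 * cos s\<close> by powers of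
    \<open>m\<close>: \<open>B1\<close> is the cross term and \<open>B2\<close> the square of
    \<open>u\<close>, while \<open>B0\<close> keeps from the leading square only the part quadratic
    in \<open>M - M0\<close>.\<close>
  define B1 where "B1 x y = bmult ((1/4) *\<^sub>R bmult (cosb 1) (proj x)) (u y)" for x y
  define B2 where "B2 x y = bmult ((1/8) *\<^sub>R bmult (cosb 1) (u x)) (u y)" for x y
  have B: "bounded_bilinear B0" "bounded_bilinear B1" "bounded_bilinear B2"
    unfolding B0_def[abs_def] B1_def[abs_def] B2_def[abs_def]
    by (intro bounded_bilinear.comp[OF bounded_bilinear_bmult] mulcos u bounded_linear_proj)+
  define Lw where "Lw M = (- omega2 / 2) *\<^sub>R w M" for M
  have Lw: "bounded_linear Lw"
    unfolding Lw_def[abs_def] by (intro bounded_linear_const_scaleR w)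
  define f where "f m M = B0 (M - M0) (M - M0) + m *\<^sub>R (Lw M + B1 M M) + m\<^sup>2 *\<^sub>R B2 M M" for m M
  have M0_per: "M0 \<in> per" by (simp add: M0_def per_intros cosb_per sinb_per)
  have f_per: "M0 + dinv (f m M) \<in> per" if "M \<in> per" for m M
    using that by (simp add: f_def B0_def B1_def B2_def Lw_def u_def w_def per_intros dinv_per
      bmult_per proj_per cosb_per corr_per cont M0_per)
  obtain \<delta> C X where \<delta>: "\<delta> > 0" and X: "\<And>m. \<bar>m\<bar> < \<delta> \<Longrightarrow> X m \<in> per \<and> norm (X m - M0) \<le> C * \<bar>m\<bar>
      \<and> M0 + dinv (f m (X m)) = X m"
    using quadratic_perturbed_fixed_point[OF bounded_linear_dinv Lw B closed_per M0_per,
      of "\<lambda>m M. M0 + dinv (f m M)"] f_per by (auto simp: f_def)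
  have "X m s - proj (X m) s =
      omega2 * (cosc (X m) * sin s - sinc (X m) * cos s - m * (corr L' (X m) s - corr K' (X m) s)) / 2
      + (proj (X m) s + m * (corr K (X m) s + corr L (X m) s))\<^sup>2 / 8 * cos s" if "\<bar>m\<bar> < \<delta>" for m s
  proof (rule fixed_point_solves[where f = "f m (X m)"])
    show "X m = M0 + dinv (f m (X m))" using X[OF that] by simp
  qed (simp add: f_def B0_def B1_def B2_def Lw_def u_def w_def power2_eq_square field_simps)
  with \<delta> X show ?thesis by blast
qed

text \<open>The modes are oscillators forced by \<open>m * (M - proj M)\<close>, with
  \<open>proj M\<close> a free oscillation of the first. The hypothesis \<open>eq\<close> makes this
  forcing consistent: it equates \<open>M - proj M\<close> with the nonlinearity evaluated on the
  modes.\<close>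

lemma modes_solution:
  fixes \<epsilon> m :: real and M K K' L L'
  defines "m \<equiv> \<epsilon> * sqrt 2 / omega2\<^sup>2"
  defines "y s \<equiv> proj M s + m * corr K M s" and "z s \<equiv> m * corr L M s"
  assumes K: "green_kernel 1 K K'" and L: "green_kernel slow_freq L L'" and M: "M \<in> per"
    and eq: "\<And>s. M s - proj M s =
      omega2 * (cosc M * sin s - sinc M * cos s - m * (corr L' M s - corr K' M s)) / 2
      + (proj M s + m * (corr K M s + corr L M s))\<^sup>2 / 8 * cos s"
  shows "is_periodic_solution \<epsilon>
    (\<lambda>\<tau>. (y (omega2 * \<tau>) + z (omega2 * \<tau>)) / (2 * sqrt 2)) (\<lambda>\<tau>. (z (omega2 * \<tau>) - y (omega2 * \<tau>)) / 2)"
proof -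
  define y' where "y' s = - cosc M * sin s + sinc M * cos s - m * corr K' M s" for s
  define z' where "z' s = - m * corr L' M s" for s
  have y: "(y has_real_derivative y' s) (at s)" for s
    unfolding y_def[abs_def] y'_def proj_apply
    by (auto intro!: derivative_eq_intros green_kernel_solves(1)[OF K M])
  have z: "(z has_real_derivative z' s) (at s)" for s
    unfolding z_def[abs_def] z'_def
    by (auto intro!: derivative_eq_intros green_kernel_solves(1)[OF L M])
  have y': "(y' has_real_derivative - y s + m * (M s - proj M s)) (at s)" for s
    unfolding y_def y'_def[abs_def]
    by (auto intro!: derivative_eq_intros green_kernel_solves(2)[OF K M] simp: proj_apply algebra_simps)
  have z': "(z' has_real_derivative - slow_freq\<^sup>2 * z s + m * (M s - proj M s)) (at s)" for s
    unfolding z_def z'_def[abs_def]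
    by (auto intro!: derivative_eq_intros green_kernel_solves(2)[OF L M] simp: algebra_simps)
  have chain: "((\<lambda>\<tau>. g (omega2 * \<tau>)) has_real_derivative g' (omega2 * \<tau>) * omega2) (at \<tau>)"
    if "\<And>s. (g has_real_derivative g' s) (at s)" for g g' \<tau>
    by (rule DERIV_chain2[OF that]) (auto intro!: derivative_eq_intros)
  note ders = chain[OF y] chain[OF z] chain[OF y'] chain[OF z']
  have per: "y (s + 2 * pi) = y s" "z (s + 2 * pi) = z s" for s
    using corr_per[OF green_kernel_continuous(1)[OF K] M] corr_per[OF green_kernel_continuous(1)[OF L] M]
    by (simp_all add: y_def z_def proj_apply per_def)
  have "is_solution \<epsilon> (\<lambda>\<tau>. (y (omega2 * \<tau>) + z (omega2 * \<tau>)) / (2 * sqrt 2)) (\<lambda>\<tau>. (z (omega2 * \<tau>) - y (omega2 * \<tau>)) / 2)"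
    unfolding is_solution_def
  proof (intro exI allI conjI)
    fix \<tau>
    let ?s = "omega2 * \<tau>"
    let ?v2 = "\<lambda>\<tau>. omega2 * (z' (omega2 * \<tau>) - y' (omega2 * \<tau>)) / 2"
    let ?v1 = "\<lambda>\<tau>. omega2 * (y' (omega2 * \<tau>) + z' (omega2 * \<tau>)) / (2 * sqrt 2)"
    show "((\<lambda>\<tau>. (y (omega2 * \<tau>) + z (omega2 * \<tau>)) / (2 * sqrt 2)) has_real_derivative ?v1 \<tau>) (at \<tau>)"
      by (rule DERIV_cong[OF DERIV_cdivide[OF DERIV_add[OF ders(1,2)]]]) (simp add: algebra_simps)
    show "((\<lambda>\<tau>. (z (omega2 * \<tau>) - y (omega2 * \<tau>)) / 2) has_real_derivative ?v2 \<tau>) (at \<tau>)"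
      by (rule DERIV_cong[OF DERIV_cdivide[OF DERIV_diff[OF ders(2,1)]]]) (simp add: algebra_simps)
    let ?N = "M ?s - proj M ?s"
    have N: "?N = ?v2 \<tau> + ((y ?s + z ?s) / (2 * sqrt 2))\<^sup>2 * cos ?s"
      unfolding eq[of ?s] by (simp add: y_def z_def y'_def z'_def power_divide power_mult_distrib algebra_simps)
    \<comment> \<open>The squared normal frequencies in the original time.\<close>
    have k: "omega2 * (slow_freq\<^sup>2 * omega2) = 2 - sqrt 2" "omega2 * omega2 = 2 + sqrt 2"
      using slow_freq(3) omega2_sq by (simp_all add: power2_eq_square algebra_simps)
    have m: "m * omega2\<^sup>2 = \<epsilon> * sqrt 2" using omega2_pos by (simp add: m_def)
    have r2: "sqrt 2 * (sqrt 2 * x) = 2 * x" for x by (simp flip: mult.assoc)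
    have "(?v1 has_real_derivative omega2 * ((- y ?s + m * ?N) * omega2 + (- slow_freq\<^sup>2 * z ?s + m * ?N) * omega2) / (2 * sqrt 2)) (at \<tau>)"
      by (intro DERIV_cdivide DERIV_cmult DERIV_add ders)
    moreover have "omega2 * ((- y ?s + m * ?N) * omega2 + (- slow_freq\<^sup>2 * z ?s + m * ?N) * omega2) / (2 * sqrt 2)
      = - 2 * ((y ?s + z ?s) / (2 * sqrt 2)) + (z ?s - y ?s) / 2 + \<epsilon> * ?N"
    proof -
      have "omega2 * ((- y ?s + m * ?N) * omega2 + (- slow_freq\<^sup>2 * z ?s + m * ?N) * omega2)
         = - (2 + sqrt 2) * y ?s - (2 - sqrt 2) * z ?s + 2 * (\<epsilon> * sqrt 2) * ?N"
        using k m by algebra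
      also have "\<dots> / (2 * sqrt 2) = - 2 * ((y ?s + z ?s) / (2 * sqrt 2)) + (z ?s - y ?s) / 2 + \<epsilon> * ?N"
        by (simp add: field_simps)
      finally show ?thesis .
    qed
    ultimately show "(?v1 has_real_derivative
        - 2 * ((y ?s + z ?s) / (2 * sqrt 2)) + (z ?s - y ?s) / 2 +
        \<epsilon> * (?v2 \<tau> + ((y ?s + z ?s) / (2 * sqrt 2))\<^sup>2 * cos ?s)) (at \<tau>)"
      by (simp only: N)
    \<comment> \<open>Both modes carry the same forcing, which cancels in \<open>z - y\<close>;
      hence the second equation is unperturbed.\<close>
    have "(?v2 has_real_derivative omega2 * ((- slow_freq\<^sup>2 * z ?s + m * ?N) * omega2 - (- y ?s + m * ?N) * omega2) / 2) (at \<tau>)"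
      by (intro DERIV_cdivide DERIV_cmult DERIV_diff ders)
    moreover have "omega2 * ((- slow_freq\<^sup>2 * z ?s + m * ?N) * omega2 - (- y ?s + m * ?N) * omega2) / 2
       = 2 * ((y ?s + z ?s) / (2 * sqrt 2)) - 2 * ((z ?s - y ?s) / 2)"
    proof -
      have "omega2 * ((- slow_freq\<^sup>2 * z ?s + m * ?N) * omega2 - (- y ?s + m * ?N) * omega2)
          = (2 + sqrt 2) * y ?s - (2 - sqrt 2) * z ?s"
        using k by algebra
      also have "\<dots> / 2 = 2 * ((y ?s + z ?s) / (2 * sqrt 2)) - 2 * ((z ?s - y ?s) / 2)"
        by (simp add: field_simps r2)
      finally show ?thesis .
    qed
    ultimately show "(?v2 has_real_derivative
        2 * ((y ?s + z ?s) / (2 * sqrt 2)) - 2 * ((z ?s - y ?s) / 2)) (at \<tau>)"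
      by (simp only:)
  qed
  moreover have "\<exists>T>0. periodic_fun_simple (\<lambda>\<tau>. ((y (omega2 * \<tau>) + z (omega2 * \<tau>)) / (2 * sqrt 2),
      (z (omega2 * \<tau>) - y (omega2 * \<tau>)) / 2)) T"
  proof (intro exI conjI)
    show "2 * pi / omega2 > 0" using omega2_pos by simp
    have "omega2 * (\<tau> + 2 * pi / omega2) = omega2 * \<tau> + 2 * pi" for \<tau>
      using omega2_pos by (simp add: field_simps)
    then show "periodic_fun_simple (\<lambda>\<tau>. ((y (omega2 * \<tau>) + z (omega2 * \<tau>)) / (2 * sqrt 2),
      (z (omega2 * \<tau>) - y (omega2 * \<tau>)) / 2)) (2 * pi / omega2)"
      by unfold_locales (simp add: per)
  qed
  ultimately show ?thesis by (simp add: is_periodic_solution_def)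
qed

section \<open>The limit as \<epsilon> tends to 0\<close>

lemma proj_M0: "proj M0 s = 16 * omega2 * sin s"
  by (simp add: proj_apply coeff_M0)

text \<open>Since \<open>W0_star = - 8 * omega2\<^sup>2\<close>, the unperturbed orbit is the pure
  fast mode \<open>y = proj M0\<close>, \<open>z = 0\<close>.\<close>

lemma unperturbed_star:
  "unperturbed1 Z0_star W0_star \<tau> = proj M0 (omega2 * \<tau>) / (2 * sqrt 2)"
  "unperturbed2 Z0_star W0_star \<tau> = - proj M0 (omega2 * \<tau>) / 2"
proof -
  have "sqrt (4 + 2 * sqrt 2) = sqrt 2 * omega2"
    unfolding omega2_def real_sqrt_mult[symmetric] by (simp add: algebra_simps)
  moreover have "2 + sqrt 2 = omega2 * omega2" "sqrt (2 + sqrt 2) = omega2"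
    using omega2_sq by (simp_all add: power2_eq_square omega2_def)
  ultimately show "unperturbed1 Z0_star W0_star \<tau> = proj M0 (omega2 * \<tau>) / (2 * sqrt 2)"
    "unperturbed2 Z0_star W0_star \<tau> = - proj M0 (omega2 * \<tau>) / 2"
    using omega2_pos
    by (simp_all add: unperturbed1_def unperturbed2_def Z0_star_def W0_star_def proj_M0 field_simps)
qed

theorem corollary4:
  shows "is_periodic_solution 0 (unperturbed1 Z0_star W0_star) (unperturbed2 Z0_star W0_star) \<and>
    (\<exists>\<epsilon>0>0. \<exists>\<theta>1 \<theta>2 :: real \<Rightarrow> real \<Rightarrow> real.
       (\<forall>\<epsilon>. 0 < \<bar>\<epsilon>\<bar> \<and> \<bar>\<epsilon>\<bar> < \<epsilon>0 \<longrightarrow>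
          is_periodic_solution \<epsilon> (\<lambda>\<tau>. \<theta>1 \<tau> \<epsilon>) (\<lambda>\<tau>. \<theta>2 \<tau> \<epsilon>)) \<and>
       (\<forall>\<tau>. ((\<lambda>\<epsilon>. \<theta>1 \<tau> \<epsilon>) \<longlongrightarrow> unperturbed1 Z0_star W0_star \<tau>) (at 0) \<and>
            ((\<lambda>\<epsilon>. \<theta>2 \<tau> \<epsilon>) \<longlongrightarrow> unperturbed2 Z0_star W0_star \<tau>) (at 0)))"
proof -
  obtain K K' where K: "green_kernel 1 K K'" using green_kernel_1 by blast
  obtain L L' where L: "green_kernel slow_freq L L'"
    using ex_green_kernel_lt_1[OF slow_freq(1,2)] by blast
  note cont = green_kernel_continuous[OF K] green_kernel_continuous[OF L]
  obtain \<delta> C X where \<delta>: "\<delta> > 0" and per: "\<And>m. \<bar>m\<bar> < \<delta> \<Longrightarrow> X m \<in> per"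
    and bound: "\<And>m. \<bar>m\<bar> < \<delta> \<Longrightarrow> norm (X m - M0) \<le> C * \<bar>m\<bar>"
    and eq: "\<And>m s. \<bar>m\<bar> < \<delta> \<Longrightarrow> X m s - proj (X m) s =
      omega2 * (cosc (X m) * sin s - sinc (X m) * cos s - m * (corr L' (X m) s - corr K' (X m) s)) / 2
      + (proj (X m) s + m * (corr K (X m) s + corr L (X m) s))\<^sup>2 / 8 * cos s"
    using ex_fixed_points[OF cont(1,3,2,4)] by metis
  define c where "c = sqrt 2 / omega2\<^sup>2"
  have c: "c > 0" using omega2_pos by (simp add: c_def)
  define Y where "Y \<epsilon> s = proj (X (\<epsilon> * c)) s + \<epsilon> * c * corr K (X (\<epsilon> * c)) s" for \<epsilon> s
  define Z where "Z \<epsilon> s = \<epsilon> * c * corr L (X (\<epsilon> * c)) s" for \<epsilon> s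
  define \<theta>1 where "\<theta>1 \<tau> \<epsilon> = (Y \<epsilon> (omega2 * \<tau>) + Z \<epsilon> (omega2 * \<tau>)) / (2 * sqrt 2)" for \<tau> \<epsilon>
  define \<theta>2 where "\<theta>2 \<tau> \<epsilon> = (Z \<epsilon> (omega2 * \<tau>) - Y \<epsilon> (omega2 * \<tau>)) / 2" for \<tau> \<epsilon>
  have sol: "is_periodic_solution \<epsilon> (\<lambda>\<tau>. \<theta>1 \<tau> \<epsilon>) (\<lambda>\<tau>. \<theta>2 \<tau> \<epsilon>)" if "\<bar>\<epsilon>\<bar> < \<delta> / c" for \<epsilon>
  proof -
    have m: "\<bar>\<epsilon> * c\<bar> < \<delta>" using that c by (simp add: abs_mult field_simps)
    have e: "\<epsilon> * sqrt 2 / omega2\<^sup>2 = \<epsilon> * c" by (simp add: c_def)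
    show ?thesis
      using modes_solution[OF K L per[OF m], of \<epsilon>, unfolded e, OF eq[OF m]]
      by (simp add: \<theta>1_def \<theta>2_def Y_def Z_def)
  qed
  \<comment> \<open>The linear bound forces equality at \<open>m = 0\<close>, so the family passes
    exactly through the unperturbed solution.\<close>
  have X0: "X 0 = M0" using bound[of 0] \<delta> by simp
  have "(X \<longlongrightarrow> M0) (at 0)"
  proof (rule Lim_transform_bound[THEN Lim_null[THEN iffD2]])
    show "((\<lambda>m. C * \<bar>m\<bar>) \<longlongrightarrow> 0) (at 0)" by (auto intro!: tendsto_eq_intros)
    show "\<forall>\<^sub>F m in at 0. norm (X m - M0) \<le> norm (C * \<bar>m\<bar>)"
      using bound \<delta> by (auto simp: eventually_at dist_real_def intro!: exI[of _ \<delta>] order_trans[OF bound])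
  qed
  then have "isCont X 0" by (simp add: isCont_def X0)
  moreover have "((\<lambda>\<epsilon>. \<epsilon> * c) \<longlongrightarrow> 0) (at 0)" by (auto intro!: tendsto_eq_intros)
  ultimately have lim: "((\<lambda>\<epsilon>. X (\<epsilon> * c)) \<longlongrightarrow> M0) (at 0)"
    using isCont_o2[where f = "\<lambda>\<epsilon>. \<epsilon> * c" and a = 0 and g = X] by (simp add: isCont_def X0)
  \<comment> \<open>Sup-norm convergence survives a bounded operator followed by evaluation at a
    point.\<close>
  have lin: "((\<lambda>\<epsilon>. A (X (\<epsilon> * c)) s) \<longlongrightarrow> A M0 s) (at 0)"
    if "bounded_linear A" for A :: "_ \<Rightarrow> (real \<Rightarrow>\<^sub>C real)" and s
    using bounded_linear.tendsto[OF bounded_linear_compose[OF bounded_linear_apply_bcontfun that] lim] .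
  have "((\<lambda>\<epsilon>. Y \<epsilon> s) \<longlongrightarrow> proj M0 s) (at 0)" "((\<lambda>\<epsilon>. Z \<epsilon> s) \<longlongrightarrow> 0) (at 0)" for s
    unfolding Y_def Z_def
    by (auto intro!: tendsto_eq_intros lin bounded_linear_proj bounded_linear_corr cont)
  then have "((\<lambda>\<epsilon>. \<theta>1 \<tau> \<epsilon>) \<longlongrightarrow> unperturbed1 Z0_star W0_star \<tau>) (at 0)"
    "((\<lambda>\<epsilon>. \<theta>2 \<tau> \<epsilon>) \<longlongrightarrow> unperturbed2 Z0_star W0_star \<tau>) (at 0)" for \<tau>
    unfolding \<theta>1_def \<theta>2_def unperturbed_star
    by (auto intro!: tendsto_eq_intros)
  \<comment> \<open>The unperturbed solution is the member of the family at \<epsilon> = 0.\<close>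
  moreover have "is_periodic_solution 0 (unperturbed1 Z0_star W0_star) (unperturbed2 Z0_star W0_star)"
    using sol[of 0] \<delta> c by (simp add: \<theta>1_def \<theta>2_def Y_def Z_def X0 unperturbed_star[abs_def])
  moreover have "\<delta> / c > 0" using \<delta> c by simp
  ultimately show ?thesis using sol by blast
qed

end
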